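(* Let $p\geq5$ be a prime, $q$ a power of $p$, $m\geq1$, and let $\mathcal{S}$ be the Sylow $p$-subgroup of $\mathrm{U}_{2m+1}(\mathbb{F}_q)$ consisting of its lower unitriangular matrices. Then $\mathfrak{X}(\mathcal{S})=\mathcal{S}$.
   Context: $\overline{x}=x^q$ on $\mathbb{F}_{q^2}$; $Q_{2m+1}$ is the $(2m+1)\times(2m+1)$ matrix with $1$ on the skew-diagonal and $0$ elsewhere; $\mathrm{U}_{2m+1}(\mathbb{F}_q)=\{A\in\mathrm{GL}_{2m+1}(\mathbb{F}_{q^2}):\overline{A}^TQ_{2m+1}A=Q_{2m+1}\}$. Commutators: $[x,y]=x^{-1}y^{-1}xy$, $[X,Y;1]=[X,Y]$, $[X,Y;k]=[[X,Y;k-1],Y]$; $\Omega_1(H)$ is generated by the elements of order $p$ of $H$. For a finite $p$-group $S$, the Oliver subgroup $\mathfrak{X}(S)$ is the unique largest normal subgroup $K$ of $S$ admitting a chain $1=Q_0\leq\cdots\leq Q_k=K$ of normal subgroups of $S$ with $[\Omega_1(C_S(Q_{i-1})),Q_i;p-1]=1$ for all $1\le i\le k$. *)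

theory Defs
  imports "HOL-Algebra.Multiplicative_Group" "HOL-Algebra.Generated_Groups"
          "Jordan_Normal_Form.Matrix"
begin

definition gcomm :: "('g, 'b) monoid_scheme \<Rightarrow> 'g \<Rightarrow> 'g \<Rightarrow> 'g" where
  "gcomm G x y = inv\<^bsub>G\<^esub> x \<otimes>\<^bsub>G\<^esub> inv\<^bsub>G\<^esub> y \<otimes>\<^bsub>G\<^esub> x \<otimes>\<^bsub>G\<^esub> y"

definition comm_sub :: "('g, 'b) monoid_scheme \<Rightarrow> 'g set \<Rightarrow> 'g set \<Rightarrow> 'g set" where
  "comm_sub G X Y = generate G {gcomm G x y | x y. x \<in> X \<and> y \<in> Y}"

fun comm_iter :: "('g, 'b) monoid_scheme \<Rightarrow> 'g set \<Rightarrow> 'g set \<Rightarrow> nat \<Rightarrow> 'g set" where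
  "comm_iter G X Y 0 = X"
| "comm_iter G X Y (Suc k) = comm_sub G (comm_iter G X Y k) Y"

definition Omega1 :: "('g, 'b) monoid_scheme \<Rightarrow> nat \<Rightarrow> 'g set \<Rightarrow> 'g set" where
  "Omega1 G p H = generate G {x \<in> H. group.ord G x = p}"

definition centralizer_set :: "('g, 'b) monoid_scheme \<Rightarrow> 'g set \<Rightarrow> 'g set" where
  "centralizer_set G Q = {g \<in> carrier G. \<forall>h \<in> Q. g \<otimes>\<^bsub>G\<^esub> h = h \<otimes>\<^bsub>G\<^esub> g}"

definition oliver_chain :: "('g, 'b) monoid_scheme \<Rightarrow> nat \<Rightarrow> 'g set \<Rightarrow> bool" where
  "oliver_chain G p K \<longleftrightarrow> (\<exists>(k::nat) (Qs :: nat \<Rightarrow> 'g set).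
      Qs 0 = {\<one>\<^bsub>G\<^esub>} \<and> Qs k = K \<and>
      (\<forall>i \<le> k. Qs i \<lhd> G) \<and>
      (\<forall>i < k. Qs i \<subseteq> Qs (Suc i)) \<and>
      (\<forall>i \<in> {1..k}. comm_iter G (Omega1 G p (centralizer_set G (Qs (i - 1)))) (Qs i) (p - 1)
                       = {\<one>\<^bsub>G\<^esub>}))"

definition oliver_subgroup :: "('g, 'b) monoid_scheme \<Rightarrow> nat \<Rightarrow> 'g set" where
  "oliver_subgroup G p = (THE K. K \<lhd> G \<and> oliver_chain G p K \<and>
      (\<forall>K'. K' \<lhd> G \<and> oliver_chain G p K' \<longrightarrow> K' \<subseteq> K))"

definition skew_id :: "nat \<Rightarrow> 'a :: {zero,one} mat" where
  "skew_id n = mat n n (\<lambda>(i,j). if i + j = n - 1 then 1 else 0)"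

definition frob_bar :: "nat \<Rightarrow> 'a :: field mat \<Rightarrow> 'a mat" where
  "frob_bar q A = map_mat (\<lambda>x. x ^ q) A"

definition unitary_group_set :: "nat \<Rightarrow> nat \<Rightarrow> 'a :: field mat set" where
  "unitary_group_set q n = {A \<in> carrier_mat n n. invertible_mat A \<and>
      transpose_mat (frob_bar q A) * skew_id n * A = skew_id n}"

definition lower_unitriangular :: "'a :: {zero,one} mat \<Rightarrow> bool" where
  "lower_unitriangular A \<longleftrightarrow> (\<forall>i < dim_row A. A $$ (i,i) = 1 \<and>
      (\<forall>j < dim_col A. i < j \<longrightarrow> A $$ (i,j) = 0))"

definition lower_unitri_unitary :: "nat \<Rightarrow> nat \<Rightarrow> 'a :: field mat monoid" where
  "lower_unitri_unitary q n =
     \<lparr>partial_object.carrier = {A \<in> unitary_group_set q n. lower_unitriangular A},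
      monoid.mult = (\<lambda>A B. A * B), monoid.one = 1\<^sub>m n\<rparr>"

end

theory Submission
  imports Defs "Jordan_Normal_Form.Determinant"
begin

text \<open>
  Number the basis from \<open>0\<close> to \<open>2m\<close> and let \<open>K\<^sub>c\<close> be the normal subgroup of those elements of
  \<open>S\<close> that fix \<open>e\<^sub>c, \<dots>, e\<^bsub>2m\<^esub>\<close>; by unitarity, the rows \<open>i \<le> 2m - c\<close> of its elements are also
  those of the identity. The chain \<open>1 \<le> K\<^bsub>m+1\<^esub> \<le> \<dots> \<le> K\<^bsub>2m\<^esub> = S\<close> shows that the Oliver subgroup
  is \<open>S\<close>. Commuting with the root elements \<open>1 + a E\<^bsub>r,0\<^esub> - a\<^sup>q E\<^bsub>2m,2m-r\<^esub> + b E\<^bsub>2m,0\<^esub>\<close> forces the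
  centralizer of \<open>K\<^sub>c\<close> into \<open>K\<^bsub>2m+1-c\<^esub>\<close>, and comparing supports gives
  \<open>[K\<^bsub>2m+1-c\<^esub>, K\<^bsub>c+1\<^esub>; 3] = 1\<close>. The first step costs one further commutator, because
  \<open>[S, K\<^bsub>m+1\<^esub>] \<le> K\<^bsub>m+1\<^esub>\<close>; four commutators are available as \<open>p \<ge> 5\<close>.
\<close>

section \<open>Iterated commutators\<close>

context group
begin

lemma gcomm_closed [simp]:
  "\<lbrakk>x \<in> carrier G; y \<in> carrier G\<rbrakk> \<Longrightarrow> gcomm G x y \<in> carrier G"
  by (simp add: gcomm_def)

lemma gcomm_eq_inv_mult:
  assumes "x \<in> carrier G" "y \<in> carrier G"
  shows "gcomm G x y = inv (y \<otimes> x) \<otimes> (x \<otimes> y)"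
  using assms by (simp add: gcomm_def inv_mult_group m_assoc)

lemma conj_eq_mult_gcomm:
  assumes "x \<in> carrier G" "h \<in> carrier G"
  shows "x \<otimes> h \<otimes> inv x = h \<otimes> gcomm G h (inv x)"
  using assms by (simp add: gcomm_def flip: m_assoc)

text \<open>Commutator subgroups are generated sets, but as every \<open>H i\<close> is a subgroup
  only single commutators have to be estimated.\<close>

lemma comm_iter_subset:
  assumes "X \<subseteq> H 0" and "\<And>i. subgroup (H i) G"
    and "\<And>i x y. \<lbrakk>x \<in> H i; y \<in> Y\<rbrakk> \<Longrightarrow> gcomm G x y \<in> H (Suc i)"
  shows "comm_iter G X Y k \<subseteq> H k"
proof (induction k)
  case (Suc k)
  then show ?case
    unfolding comm_iter.simps comm_sub_def
    by (intro generate_subgroup_incl assms(2)) (use assms(3) in blast)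
qed (use assms(1) in simp)

lemma one_in_comm_iter: "0 < k \<Longrightarrow> \<one> \<in> comm_iter G X Y k"
  by (cases k) (auto simp: comm_sub_def intro: generate.one)

lemma Omega1_subset: "subgroup H G \<Longrightarrow> A \<subseteq> H \<Longrightarrow> Omega1 G p A \<subseteq> H"
  unfolding Omega1_def by (rule generate_subgroup_incl) auto

text \<open>The carrier contains every normal subgroup, so once it has a chain it is the unique
  maximum that \<open>THE\<close> asks for.\<close>

lemma oliver_subgroup_eq_carrierI:
  assumes "oliver_chain G p (carrier G)"
  shows "oliver_subgroup G p = carrier G"
  unfolding oliver_subgroup_def
proof (rule the_equality)
  have n: "carrier G \<lhd> G"
    by (rule normal_invI[OF subgroup_self]) auto
  show "carrier G \<lhd> G \<and> oliver_chain G p (carrier G) \<and>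
      (\<forall>K'. K' \<lhd> G \<and> oliver_chain G p K' \<longrightarrow> K' \<subseteq> carrier G)"
    using n assms normal_imp_subgroup subgroup.subset by blast
  fix K
  assume K: "K \<lhd> G \<and> oliver_chain G p K \<and> (\<forall>K'. K' \<lhd> G \<and> oliver_chain G p K' \<longrightarrow> K' \<subseteq> K)"
  show "K = carrier G"
    using K n assms normal_imp_subgroup subgroup.subset by blast
qed

end

section \<open>The group of lower unitriangular unitary matrices\<close>

lemma mult_entry:
  assumes "A \<in> carrier_mat n n" "B \<in> carrier_mat n n" "i < n" "j < n"
  shows "(A * B) $$ (i, j) = (\<Sum>k<n. A $$ (i, k) * B $$ (k, j))"
  using assms by (simp add: scalar_prod_def atLeast0LessThan)

lemma lower_unitriangular_iff:
  assumes "A \<in> carrier_mat n n"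
  shows "lower_unitriangular A \<longleftrightarrow>
    (\<forall>i<n. A $$ (i, i) = 1) \<and> (\<forall>i<n. \<forall>j<n. i < j \<longrightarrow> A $$ (i, j) = 0)"
  using assms by (auto simp: lower_unitriangular_def)

text \<open>The terms \<open>k = i\<close> and \<open>k = j\<close> give the linear part; the rest
  involves strictly lower entries only.\<close>

lemma lower_unitriangular_mult_entry:
  fixes A B :: "'a :: field mat"
  assumes A: "A \<in> carrier_mat n n" "lower_unitriangular A"
    and B: "B \<in> carrier_mat n n" "lower_unitriangular B"
    and ij: "i < n" "j < i"
  shows "(A * B) $$ (i, j) =
    A $$ (i, j) + B $$ (i, j) + (\<Sum>k\<in>{j<..<i}. A $$ (i, k) * B $$ (k, j))"
proof -
  have a: "A $$ (i, i) = 1" "\<And>k. k < n \<Longrightarrow> i < k \<Longrightarrow> A $$ (i, k) = 0"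
    and b: "B $$ (j, j) = 1" "\<And>k. k < n \<Longrightarrow> k < j \<Longrightarrow> B $$ (k, j) = 0"
    using A B ij by (auto simp: lower_unitriangular_iff)
  have "(A * B) $$ (i, j) = (\<Sum>k<n. A $$ (i, k) * B $$ (k, j))"
    using A B ij by (intro mult_entry) auto
  also have "\<dots> = (\<Sum>k\<in>insert i (insert j {j<..<i}). A $$ (i, k) * B $$ (k, j))"
    using a b ij by (intro sum.mono_neutral_right) (auto simp: not_less)
  also have "\<dots> = A $$ (i, j) + B $$ (i, j) + (\<Sum>k\<in>{j<..<i}. A $$ (i, k) * B $$ (k, j))"
    using a b ij by simp
  finally show ?thesis .
qed

lemma lower_unitriangular_mult:
  fixes A B :: "'a :: field mat"
  assumes A: "A \<in> carrier_mat n n" "lower_unitriangular A"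
    and B: "B \<in> carrier_mat n n" "lower_unitriangular B"
  shows "lower_unitriangular (A * B)"
proof -
  have AB: "A * B \<in> carrier_mat n n"
    using A B by simp
  have "(A * B) $$ (i, j) = (if i = j then 1 else 0)" if ij: "i < n" "j < n" "i \<le> j" for i j
  proof -
    have z: "A $$ (i, k) * B $$ (k, j) = (if k = i then if i = j then 1 else 0 else 0)"
      if "k < n" for k
      using A B that ij by (cases k i rule: linorder_cases) (auto simp: lower_unitriangular_iff)
    show ?thesis
      using A B ij by (subst mult_entry[of A n B]) (simp_all add: z)
  qed
  then show ?thesis
    unfolding lower_unitriangular_iff[OF AB] by auto
qed

lemma lower_unitriangular_one: "lower_unitriangular (1\<^sub>m n)"
  by (auto simp: lower_unitriangular_def)

lemma skew_id_carrier [simp]: "skew_id n \<in> carrier_mat n n"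
  by (simp add: skew_id_def)

lemma skew_id_mult_entry:
  fixes A :: "'a :: field mat"
  assumes "A \<in> carrier_mat n n" "i < n" "j < n"
  shows "(skew_id n * A) $$ (i, j) = A $$ (n - Suc i, j)"
    and "(A * skew_id n) $$ (i, j) = A $$ (i, n - Suc j)"
proof -
  have "(skew_id n * A) $$ (i, j) = (\<Sum>k<n. if k = n - Suc i then A $$ (k, j) else 0)"
    unfolding mult_entry[OF skew_id_carrier assms]
    by (rule sum.cong) (use assms in \<open>auto simp: skew_id_def\<close>)
  then show "(skew_id n * A) $$ (i, j) = A $$ (n - Suc i, j)"
    using assms by simp
  have "(A * skew_id n) $$ (i, j) = (\<Sum>k<n. if k = n - Suc j then A $$ (i, k) else 0)"
    unfolding mult_entry[OF assms(1) skew_id_carrier assms(2,3)]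
    by (rule sum.cong) (use assms in \<open>auto simp: skew_id_def\<close>)
  then show "(A * skew_id n) $$ (i, j) = A $$ (i, n - Suc j)"
    using assms by simp
qed

lemma skew_id_square: "skew_id n * skew_id n = (1\<^sub>m n :: 'a :: field mat)"
proof (rule eq_matI)
  fix i j assume "i < dim_row (1\<^sub>m n :: 'a mat)" "j < dim_col (1\<^sub>m n :: 'a mat)"
  then show "(skew_id n * skew_id n) $$ (i, j) = (1\<^sub>m n :: 'a mat) $$ (i, j)"
    by (subst skew_id_mult_entry) (auto simp: skew_id_def)
qed (auto simp: skew_id_def)

locale unitary_unipotent =
  fixes q n :: nat and S :: "'a :: field mat monoid" (structure)
  assumes q_pos: "0 < q"
    and frob_add: "\<And>x y :: 'a. (x + y) ^ q = x ^ q + y ^ q"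
    and S_eq: "S = lower_unitri_unitary q n"
begin

text \<open>The adjoint with respect to the Hermitian form with Gram matrix \<open>skew_id n\<close>.\<close>
definition adj :: "'a mat \<Rightarrow> 'a mat" where
  "adj A = mat n n (\<lambda>(i, j). (A $$ (n - Suc j, n - Suc i)) ^ q)"

lemma adj_carrier [simp]: "adj A \<in> carrier_mat n n"
  by (simp add: adj_def)

lemma frob_sum: "(\<Sum>i\<in>I. f i :: 'a) ^ q = (\<Sum>i\<in>I. f i ^ q)"
  using q_pos by (induction I rule: infinite_finite_induct) (auto simp: frob_add)

lemma frob_minus: "(- x :: 'a) ^ q = - (x ^ q)"
  using frob_add[of x "- x"] q_pos by (simp add: eq_neg_iff_add_eq_0 add.commute power_0_left)

text \<open>\<open>adj\<close> reflects in the skew-diagonal, which reverses products as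
  transposition does, and applies the Frobenius entrywise.\<close>

lemma adj_mult:
  assumes "A \<in> carrier_mat n n" "B \<in> carrier_mat n n"
  shows "adj (A * B) = adj B * adj A"
proof (rule eq_matI)
  fix i j assume "i < dim_row (adj B * adj A)" "j < dim_col (adj B * adj A)"
  then have ij: "i < n" "j < n"
    by (auto simp: adj_def)
  let ?f = "\<lambda>k. (B $$ (k, n - Suc i)) ^ q * (A $$ (n - Suc j, k)) ^ q"
  have "adj (A * B) $$ (i, j) = ((A * B) $$ (n - Suc j, n - Suc i)) ^ q"
    using ij by (simp add: adj_def)
  also have "\<dots> = (\<Sum>k<n. ?f k)"
    using ij assms by (subst mult_entry) (auto simp: frob_sum power_mult_distrib mult.commute)
  also have "\<dots> = (\<Sum>k<n. ?f (n - Suc k))"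
    by (rule sum.nat_diff_reindex[symmetric])
  also have "\<dots> = (adj B * adj A) $$ (i, j)"
    using ij by (subst mult_entry) (auto simp: adj_def)
  finally show "adj (A * B) $$ (i, j) = (adj B * adj A) $$ (i, j)" .
qed (auto simp: adj_def)

lemma adj_one: "adj (1\<^sub>m n) = 1\<^sub>m n"
  using q_pos by (intro eq_matI) (auto simp: adj_def)

text \<open>With \<open>J = skew_id n\<close>, the conjugate transpose of \<open>A\<close> times
  \<open>J\<close> is \<open>J * adj A\<close>; since \<open>J\<close> squares to 1 it cancels, and
  \<open>adj A\<close> is then an inverse of \<open>A\<close>.\<close>

lemma unitary_iff:
  assumes A: "A \<in> carrier_mat n n"
  shows "A \<in> unitary_group_set q n \<longleftrightarrow> adj A * A = 1\<^sub>m n"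
proof -
  have "transpose_mat (frob_bar q A) * skew_id n = skew_id n * adj A"
  proof (rule eq_matI)
    fix i j assume "i < dim_row (skew_id n * adj A)" "j < dim_col (skew_id n * adj A)"
    then have ij: "i < n" "j < n"
      by (auto simp: adj_def skew_id_def)
    have c: "transpose_mat (frob_bar q A) \<in> carrier_mat n n"
      using A by (simp add: frob_bar_def)
    show "(transpose_mat (frob_bar q A) * skew_id n) $$ (i, j) = (skew_id n * adj A) $$ (i, j)"
      using A ij unfolding skew_id_mult_entry[OF c ij] skew_id_mult_entry[OF adj_carrier ij]
      by (simp add: frob_bar_def adj_def)
  qed (use A in \<open>auto simp: adj_def skew_id_def frob_bar_def\<close>)
  then have eq: "transpose_mat (frob_bar q A) * skew_id n * A = skew_id n * (adj A * A)"
    using A by (simp add: assoc_mult_mat[of _ n n _ n _ n])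
  have "skew_id n * (adj A * A) = skew_id n \<longleftrightarrow> adj A * A = 1\<^sub>m n"
  proof
    assume "skew_id n * (adj A * A) = skew_id n"
    then have "skew_id n * (skew_id n * (adj A * A)) = 1\<^sub>m n"
      by (simp add: skew_id_square)
    then show "adj A * A = 1\<^sub>m n"
      using A assoc_mult_mat[of "skew_id n" n n "skew_id n" n "adj A * A" n]
      by (simp add: skew_id_square mult_carrier_mat[of _ n n] left_mult_one_mat[of _ n n])
  next
    assume "adj A * A = 1\<^sub>m n"
    then show "skew_id n * (adj A * A) = skew_id n"
      by (simp add: right_mult_one_mat[of _ n n])
  qed
  moreover have "invertible_mat A" if "adj A * A = 1\<^sub>m n"
    using that mat_mult_left_right_inverse[OF adj_carrier A that] A
    unfolding invertible_mat_def inverts_mat_def by (auto simp: adj_def)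
  ultimately show ?thesis
    using A eq by (auto simp: unitary_group_set_def)
qed

lemma mem_carrier_iff:
  "A \<in> carrier S \<longleftrightarrow> A \<in> carrier_mat n n \<and> lower_unitriangular A \<and> adj A * A = 1\<^sub>m n"
  using unitary_iff by (auto simp: S_eq lower_unitri_unitary_def unitary_group_set_def)

lemma mult_eq [simp]: "A \<otimes> B = A * B" and one_eq [simp]: "\<one> = 1\<^sub>m n"
  by (simp_all add: S_eq lower_unitri_unitary_def)

lemma carrierD:
  assumes "A \<in> carrier S"
  shows "A \<in> carrier_mat n n" "lower_unitriangular A" "adj A * A = 1\<^sub>m n"
    and "i < n \<Longrightarrow> A $$ (i, i) = 1" "\<lbrakk>i < n; j < n; i < j\<rbrakk> \<Longrightarrow> A $$ (i, j) = 0"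
  using assms lower_unitriangular_iff[of A n] by (auto simp: mem_carrier_iff)

text \<open>Unlike transposition, reflection in the skew-diagonal keeps the lower triangle in
  place.\<close>

lemma adj_lower_unitriangular:
  assumes "A \<in> carrier_mat n n" "lower_unitriangular A"
  shows "lower_unitriangular (adj A)"
proof -
  have "A $$ (n - Suc i, n - Suc i) = 1" if "i < n" for i
    using assms that by (auto simp: lower_unitriangular_iff)
  moreover have "A $$ (n - Suc j, n - Suc i) = 0" if "i < j" "j < n" for i j
  proof -
    have "n - Suc j < n - Suc i" "n - Suc i < n"
      using that by auto
    then show ?thesis
      using assms by (auto simp: lower_unitriangular_iff)
  qed
  ultimately show ?thesis
    using q_pos unfolding lower_unitriangular_iff[OF adj_carrier] by (auto simp: adj_def)
qed

lemma group_S: "group S"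
proof (rule groupI)
  fix A B assume A: "A \<in> carrier S" and B: "B \<in> carrier S"
  have c: "A \<in> carrier_mat n n" "B \<in> carrier_mat n n"
    using A B by (auto dest: carrierD)
  have "adj (A * B) * (A * B) = adj B * (adj A * A) * B"
    using c by (simp add: adj_mult assoc_mult_mat[of _ n n _ n _ n] mult_carrier_mat[of _ n n])
  also have "\<dots> = 1\<^sub>m n"
    using carrierD[OF A] carrierD[OF B] by (simp add: right_mult_one_mat[of _ n n])
  finally show "A \<otimes> B \<in> carrier S"
    using c carrierD[OF A] carrierD[OF B]
    by (auto simp: mem_carrier_iff intro: lower_unitriangular_mult)
next
  show "\<one> \<in> carrier S"
    by (simp add: mem_carrier_iff adj_one lower_unitriangular_one)
next
  fix A B C assume "A \<in> carrier S" "B \<in> carrier S" "C \<in> carrier S"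
  then show "A \<otimes> B \<otimes> C = A \<otimes> (B \<otimes> C)"
    by (auto simp: mem_carrier_iff)
next
  fix A assume A: "A \<in> carrier S"
  then show "\<one> \<otimes> A = A"
    by (auto simp: mem_carrier_iff)
  have "A * adj A = 1\<^sub>m n"
    using mat_mult_left_right_inverse[OF adj_carrier] carrierD[OF A] by auto
  then have "adj (adj A) * adj A = 1\<^sub>m n"
    using adj_mult[of A "adj A"] carrierD[OF A] by (simp add: adj_one)
  then have "adj A \<in> carrier S"
    using carrierD[OF A] adj_lower_unitriangular by (simp add: mem_carrier_iff)
  then show "\<exists>B\<in>carrier S. B \<otimes> A = \<one>"
    using carrierD[OF A] by auto
qed

sublocale group S
  by (rule group_S)

lemma S_mult_entry:
  assumes "A \<in> carrier S" "B \<in> carrier S" "i < n" "j < i"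
  shows "(A * B) $$ (i, j) =
    A $$ (i, j) + B $$ (i, j) + (\<Sum>k\<in>{j<..<i}. A $$ (i, k) * B $$ (k, j))"
  using assms by (intro lower_unitriangular_mult_entry) (auto dest: carrierD)

section \<open>Subgroups defined by a support condition\<close>

definition supp_sub :: "(nat \<Rightarrow> nat \<Rightarrow> bool) \<Rightarrow> 'a mat set" where
  "supp_sub P = {A \<in> carrier S. \<forall>i<n. \<forall>j<i. A $$ (i, j) \<noteq> 0 \<longrightarrow> P i j}"

text \<open>Left multiplication by a lower unitriangular matrix adds rows to lower rows, so supports
  spread down their columns.\<close>

definition row_closed :: "(nat \<Rightarrow> nat \<Rightarrow> bool) \<Rightarrow> bool" where
  "row_closed P \<longleftrightarrow> (\<forall>i i' j. P i j \<longrightarrow> i < i' \<longrightarrow> P i' j)"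

lemma supp_subD:
  assumes "A \<in> supp_sub P"
  shows "A \<in> carrier S" "\<lbrakk>A $$ (i, j) \<noteq> 0; i < n; j < i\<rbrakk> \<Longrightarrow> P i j"
  using assms by (auto simp: supp_sub_def)

lemma supp_sub_mono:
  assumes "A \<in> supp_sub P" "\<And>i j. \<lbrakk>P i j; j < i; i < n\<rbrakk> \<Longrightarrow> Q i j"
  shows "A \<in> supp_sub Q"
  using assms by (auto simp: supp_sub_def)

text \<open>Where \<open>P i j\<close> fails, it fails higher up in column \<open>j\<close> too, so
  the right factor kills the sum in \<open>S_mult_entry\<close>; inverses follow from
  \<open>inv A * A = 1\<close>.\<close>

lemma subgroup_supp_sub:
  assumes P: "row_closed P"
  shows "subgroup (supp_sub P) S"
proof (rule subgroupI)
  show "supp_sub P \<subseteq> carrier S"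
    by (auto simp: supp_sub_def)
  have "\<one> \<in> supp_sub P"
    unfolding supp_sub_def using one_closed by auto
  then show "supp_sub P \<noteq> {}"
    by blast
  fix A assume A: "A \<in> supp_sub P"
  note As = supp_subD(1)[OF A]
  have "P i j" if ij: "i < n" "j < i" and nz: "(inv A) $$ (i, j) \<noteq> 0" for i j
  proof (rule ccontr)
    assume no: "\<not> P i j"
    have "A $$ (k, j) = 0" if "j < k" "k \<le> i" for k
      using supp_subD(2)[OF A, of k j] that ij no P unfolding row_closed_def
      by (metis le_less_trans le_neq_implies_less)
    then have "(inv A * A) $$ (i, j) = (inv A) $$ (i, j)"
      using As ij by (subst S_mult_entry) auto
    moreover have "inv A * A = 1\<^sub>m n"
      using l_inv[OF As] by simp
    ultimately show False
      using nz ij by simp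
  qed
  then show "inv A \<in> supp_sub P"
    using As by (auto simp: supp_sub_def)
  fix B assume B: "B \<in> supp_sub P"
  note Bs = supp_subD(1)[OF B]
  have "P i j" if ij: "i < n" "j < i" and nz: "(A * B) $$ (i, j) \<noteq> 0" for i j
  proof (rule ccontr)
    assume no: "\<not> P i j"
    have "B $$ (k, j) = 0" if "j < k" "k \<le> i" for k
      using supp_subD(2)[OF B, of k j] that ij no P unfolding row_closed_def
      by (metis le_less_trans le_neq_implies_less)
    moreover have "A $$ (i, j) = 0"
      using supp_subD(2)[OF A] ij no by blast
    ultimately show False
      using nz ij S_mult_entry[OF As Bs ij] by simp
  qed
  then show "A \<otimes> B \<in> supp_sub P"
    using m_closed[OF As Bs] by (auto simp: supp_sub_def)
qed

text \<open>The commutator equals \<open>1 + (yx)\<^sup>-\<^sup>1 (xy - yx)\<close>, and \<open>xy - yx\<close> only involves products of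
  strictly lower triangular entries of \<open>x\<close> and \<open>y\<close>.\<close>
lemma gcomm_supp_sub:
  assumes x: "x \<in> supp_sub P1" and y: "y \<in> supp_sub P2" and P3: "row_closed P3"
    and P12: "\<And>i k j. \<lbrakk>j < k; k < i; i < n; P1 i k; P2 k j\<rbrakk> \<Longrightarrow> P3 i j"
    and P21: "\<And>i k j. \<lbrakk>j < k; k < i; i < n; P2 i k; P1 k j\<rbrakk> \<Longrightarrow> P3 i j"
  shows "gcomm S x y \<in> supp_sub P3"
proof -
  note xs = supp_subD(1)[OF x] and ys = supp_subD(1)[OF y]
  define z where "z = inv (y \<otimes> x)"
  have zs: "z \<in> carrier S"
    unfolding z_def using xs ys by blast
  have g: "gcomm S x y = z * (x * y)"
    using gcomm_eq_inv_mult[OF xs ys] by (simp add: z_def)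
  have one: "z * (y * x) = 1\<^sub>m n"
    using l_inv[OF m_closed[OF ys xs]] by (simp add: z_def)
  have ms: "x * y \<in> carrier S" "y * x \<in> carrier S"
    using m_closed[OF xs ys] m_closed[OF ys xs] by auto
  have eq: "(x * y) $$ (i, j) = (y * x) $$ (i, j)" if ij: "i < n" "j < i" and no: "\<not> P3 i j" for i j
  proof -
    have z1: "x $$ (i, k) * y $$ (k, j) = 0" if k: "k \<in> {j<..<i}" for k
    proof (rule ccontr)
      assume "x $$ (i, k) * y $$ (k, j) \<noteq> 0"
      then have "P1 i k" "P2 k j"
        using supp_subD(2)[OF x, of i k] supp_subD(2)[OF y, of k j] k ij by auto
      then show False
        using P12[of j k i] k ij no by auto
    qed
    have z2: "y $$ (i, k) * x $$ (k, j) = 0" if k: "k \<in> {j<..<i}" for k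
    proof (rule ccontr)
      assume "y $$ (i, k) * x $$ (k, j) \<noteq> 0"
      then have "P2 i k" "P1 k j"
        using supp_subD(2)[OF y, of i k] supp_subD(2)[OF x, of k j] k ij by auto
      then show False
        using P21[of j k i] k ij no by auto
    qed
    show ?thesis
      unfolding S_mult_entry[OF xs ys ij] S_mult_entry[OF ys xs ij] by (simp add: z1 z2)
  qed
  have "P3 i j" if ij: "i < n" "j < i" and nz: "gcomm S x y $$ (i, j) \<noteq> 0" for i j
  proof (rule ccontr)
    assume no: "\<not> P3 i j"
    \<comment> \<open>Row closure extends the equality up column \<open>j\<close>, so it survives
      left multiplication by \<open>z\<close>.\<close>
    have e: "(x * y) $$ (k, j) = (y * x) $$ (k, j)" if "j < k" "k \<le> i" for k
    proof (rule eq)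
      show "\<not> P3 k j"
        using P3 no that unfolding row_closed_def by (metis le_neq_implies_less)
    qed (use that ij in auto)
    have "(z * (x * y)) $$ (i, j) = (z * (y * x)) $$ (i, j)"
      unfolding S_mult_entry[OF zs ms(1) ij] S_mult_entry[OF zs ms(2) ij]
      using ij by (simp add: e)
    then show False
      using nz ij by (simp add: g one)
  qed
  then show ?thesis
    using gcomm_closed[OF xs ys] by (auto simp: supp_sub_def)
qed

lemma supp_sub_False: "supp_sub (\<lambda>i j. False) = {1\<^sub>m n}"
proof
  show "supp_sub (\<lambda>i j. False) \<subseteq> {1\<^sub>m n}"
  proof
    fix A assume A: "A \<in> supp_sub (\<lambda>i j. False)"
    have "A = 1\<^sub>m n"
    proof (rule eq_matI)
      fix i j assume "i < dim_row (1\<^sub>m n :: 'a mat)" "j < dim_col (1\<^sub>m n :: 'a mat)"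
      then show "A $$ (i, j) = 1\<^sub>m n $$ (i, j)"
        using supp_subD[OF A] carrierD(4,5)[of A] by (cases i j rule: linorder_cases) auto
    qed (use carrierD(1)[OF supp_subD(1)[OF A]] in auto)
    then show "A \<in> {1\<^sub>m n}"
      by simp
  qed
  show "{1\<^sub>m n} \<subseteq> supp_sub (\<lambda>i j. False)"
    using subgroup.one_closed[OF subgroup_supp_sub[of "\<lambda>i j. False"]] by (simp add: row_closed_def)
qed

section \<open>Pointwise stabilizers of end segments of the basis\<close>

text \<open>The elements of \<open>S\<close> that fix the basis vectors \<open>e\<^sub>c, \<dots>, e\<^bsub>n-1\<^esub>\<close>.\<close>
definition fixer :: "nat \<Rightarrow> 'a mat set" where
  "fixer c = supp_sub (\<lambda>i j. j < c)"

lemma subgroup_fixer: "subgroup (fixer c) S"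
  unfolding fixer_def by (rule subgroup_supp_sub) (simp add: row_closed_def)

lemma gcomm_fixer: "x \<in> fixer c \<Longrightarrow> y \<in> carrier S \<Longrightarrow> gcomm S x y \<in> fixer c"
  unfolding fixer_def
  by (rule gcomm_supp_sub[where ?P1.0 = "\<lambda>i j. j < c" and ?P2.0 = "\<lambda>i j. True"])
    (auto simp: row_closed_def supp_sub_def)

lemma gcomm_fixer': "x \<in> carrier S \<Longrightarrow> y \<in> fixer c \<Longrightarrow> gcomm S x y \<in> fixer c"
  unfolding fixer_def
  by (rule gcomm_supp_sub[where ?P1.0 = "\<lambda>i j. True" and ?P2.0 = "\<lambda>i j. j < c"])
    (auto simp: row_closed_def supp_sub_def)

lemma normal_fixer: "fixer c \<lhd> S"
proof (rule normal_invI[OF subgroup_fixer])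
  fix x h assume x: "x \<in> carrier S" and h: "h \<in> fixer c"
  have hs: "h \<in> carrier S"
    using h subgroup.subset[OF subgroup_fixer] by blast
  have "h \<otimes> gcomm S h (inv x) \<in> fixer c"
    by (rule subgroup.m_closed[OF subgroup_fixer h gcomm_fixer[OF h inv_closed[OF x]]])
  then show "x \<otimes> h \<otimes> inv x \<in> fixer c"
    using conj_eq_mult_gcomm[OF x hs] by simp
qed

text \<open>Fixing a subspace \<open>U\<close> pointwise forces a unitary matrix to act trivially modulo the
  orthogonal complement of \<open>U\<close>.\<close>
lemma fixer_eq: "fixer c = supp_sub (\<lambda>i j. j < c \<and> n \<le> i + c)"
proof
  show "supp_sub (\<lambda>i j. j < c \<and> n \<le> i + c) \<subseteq> fixer c"
    unfolding fixer_def by (auto elim: supp_sub_mono)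
  show "fixer c \<subseteq> supp_sub (\<lambda>i j. j < c \<and> n \<le> i + c)"
  proof
    fix A assume A: "A \<in> fixer c"
    have As: "A \<in> carrier S"
      using A by (auto simp: fixer_def supp_sub_def)
    have "A $$ (i, j) = 0" if ij: "i < n" "j < i" "i + c < n" for i j
    proof -
      \<comment> \<open>As \<open>i + c < n\<close>, column \<open>n - Suc i\<close> of
        \<open>A\<close> is that of the identity, and \<open>adj\<close> turns it into row
        \<open>i\<close>.\<close>
      have d: "adj A $$ (i, k) = (if k = i then 1 else 0)" if k: "k < n" for k
      proof (cases k i rule: linorder_cases)
        case less
        then have "\<not> n - Suc i < c" "n - Suc i < n - Suc k" "n - Suc k < n"
          using ij k by auto
        then have "A $$ (n - Suc k, n - Suc i) = 0"
          using supp_subD(2)[OF A[unfolded fixer_def]] by blast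
        then show ?thesis
          using less ij k q_pos by (simp add: adj_def)
      qed (use ij k q_pos carrierD(4,5)[OF As] in \<open>auto simp: adj_def\<close>)
      have "(adj A * A) $$ (i, j) = (\<Sum>k<n. adj A $$ (i, k) * A $$ (k, j))"
        using mult_entry[OF adj_carrier carrierD(1)[OF As]] ij by simp
      also have "\<dots> = (\<Sum>k<n. if k = i then A $$ (k, j) else 0)"
        by (intro sum.cong) (auto simp: d)
      finally have "(adj A * A) $$ (i, j) = A $$ (i, j)"
        using ij by simp
      then show ?thesis
        using carrierD(3)[OF As] ij by simp
    qed
    then show "A \<in> supp_sub (\<lambda>i j. j < c \<and> n \<le> i + c)"
      using A by (auto simp: fixer_def supp_sub_def) (meson not_le)
  qed
qed

end

section \<open>Centralizers\<close>

text \<open>"Odd" refers to the characteristic, not to \<open>n\<close>; the Frobenius is a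
  nontrivial involution.\<close>

locale unitary_unipotent_odd = unitary_unipotent +
  assumes frob_frob: "\<And>x :: 'a. (x ^ q) ^ q = x"
    and frob_nontrivial: "\<exists>a :: 'a. a ^ q \<noteq> a"
    and two_nonzero: "(2 :: 'a) \<noteq> 0"
begin

text \<open>\<open>adj\<close> exchanges the positions \<open>(r, 0)\<close> and
  \<open>(n - 1, n - Suc r)\<close>. The corner \<open>b\<close> compensates the product of their
  entries, which arises when \<open>r = n - Suc r\<close>.\<close>

definition root_elem :: "nat \<Rightarrow> 'a \<Rightarrow> 'a \<Rightarrow> 'a mat" where
  "root_elem r a b = mat n n (\<lambda>(i, j).
     if i = j then 1 else if i = r \<and> j = 0 then a
     else if i = n - 1 \<and> j = n - Suc r then - (a ^ q)
     else if i = n - 1 \<and> j = 0 then b else 0)"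

lemma root_elem_entry:
  "\<lbrakk>i < n; j < n\<rbrakk> \<Longrightarrow> root_elem r a b $$ (i, j) =
    (if i = j then 1 else if i = r \<and> j = 0 then a
     else if i = n - 1 \<and> j = n - Suc r then - (a ^ q)
     else if i = n - 1 \<and> j = 0 then b else 0)"
  by (simp add: root_elem_def)

lemma root_elem_carrier_mat [simp]: "root_elem r a b \<in> carrier_mat n n"
  by (simp add: root_elem_def)

lemma adj_root_elem:
  assumes "0 < r" "r < n - 1"
  shows "adj (root_elem r a b) = root_elem r (- a) (b ^ q)"
proof (rule eq_matI)
  fix i j assume "i < dim_row (root_elem r (- a) (b ^ q))" "j < dim_col (root_elem r (- a) (b ^ q))"
  then have ij: "i < n" "j < n"
    by (auto simp: root_elem_def)
  have e: "n - Suc j = n - Suc i \<longleftrightarrow> i = j" "n - Suc j = r \<longleftrightarrow> j = n - Suc r"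
    "n - Suc i = 0 \<longleftrightarrow> i = n - 1" "n - Suc j = n - 1 \<longleftrightarrow> j = 0"
    "n - Suc i = n - Suc r \<longleftrightarrow> i = r"
    using ij assms by auto
  have "n - Suc j < n" "n - Suc i < n" "n - Suc r \<noteq> 0" "r \<noteq> n - 1"
    using ij assms by auto
  moreover have "adj (root_elem r a b) $$ (i, j) = (root_elem r a b $$ (n - Suc j, n - Suc i)) ^ q"
    using ij by (simp add: adj_def)
  ultimately show "adj (root_elem r a b) $$ (i, j) = root_elem r (- a) (b ^ q) $$ (i, j)"
    using ij q_pos frob_minus[of a] frob_minus[of "a ^ q"] frob_frob[of a]
    by (simp only: root_elem_entry e) (simp add: power_0_left)
qed (auto simp: adj_def root_elem_def)

text \<open>The condition on \<open>b\<close> is the vanishing of the corner entry of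
  \<open>adj X * X\<close>; two off-diagonal entries meet only at \<open>k = r\<close>, when
  \<open>r = n - Suc r\<close>.\<close>

lemma root_elem_in_carrier:
  assumes r: "0 < r" "r < n - 1"
    and b: "b ^ q + b + (if r = n - Suc r then a ^ q * a else 0) = 0"
  shows "root_elem r a b \<in> carrier S"
proof -
  let ?X = "root_elem r a b" and ?Y = "root_elem r (- a) (b ^ q)"
  have l: "lower_unitriangular (root_elem r a' b')" for a' b'
    using r unfolding lower_unitriangular_iff[OF root_elem_carrier_mat]
    by (auto simp: root_elem_entry)
  have "?Y * ?X = 1\<^sub>m n"
  proof (rule eq_matI)
    fix i j assume "i < dim_row (1\<^sub>m n :: 'a mat)" "j < dim_col (1\<^sub>m n :: 'a mat)"
    then have ij: "i < n" "j < n"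
      by auto
    show "(?Y * ?X) $$ (i, j) = 1\<^sub>m n $$ (i, j)"
    proof (cases "j < i")
      case True
      have "(\<Sum>k\<in>{j<..<i}. ?Y $$ (i, k) * ?X $$ (k, j)) =
        (\<Sum>k\<in>{j<..<i}. if k = r then
            if i = n - 1 \<and> j = 0 \<and> r = n - Suc r then a ^ q * a else 0 else 0)"
        using ij by (intro sum.cong) (auto simp: root_elem_entry frob_minus)
      also have "\<dots> = (if i = n - 1 \<and> j = 0 \<and> r = n - Suc r then a ^ q * a else 0)"
        using r by auto
      finally show ?thesis
        using True ij b r
        unfolding lower_unitriangular_mult_entry[OF root_elem_carrier_mat l
            root_elem_carrier_mat l ij(1) True]
        by (auto simp: root_elem_entry frob_minus algebra_simps)
    next
      case False
      then show ?thesis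
        using ij lower_unitriangular_mult[OF root_elem_carrier_mat l root_elem_carrier_mat l,
            of "- a" "b ^ q" a b]
          lower_unitriangular_iff[OF mult_carrier_mat[OF root_elem_carrier_mat root_elem_carrier_mat]]
        by auto
    qed
  qed (auto simp: root_elem_def)
  then show ?thesis
    using l adj_root_elem[OF r] by (simp add: mem_carrier_iff)
qed

lemma root_elem_exists:
  assumes "0 < r" "r < n - 1"
  shows "\<exists>b. root_elem r a b \<in> carrier S"
proof -
  \<comment> \<open>The norm \<open>a ^ q * a\<close> is fixed by the Frobenius, so minus half of it
    solves \<open>b ^ q + b = - (a ^ q * a)\<close>.\<close>
  define b where "b = (if r = n - Suc r then - (a ^ q * a / 2) else 0)"
  have "(2 :: 'a) ^ q = 2"
    using frob_add[of 1 1] by simp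
  then have "b ^ q = b"
    using q_pos by (simp add: b_def frob_minus power_mult_distrib power_divide frob_frob mult.commute)
  then have "b ^ q + b + (if r = n - Suc r then a ^ q * a else 0) = 0"
    using two_nonzero by (simp add: b_def field_simps)
  then show ?thesis
    using root_elem_in_carrier[OF assms] by blast
qed

text \<open>Compare column 0 of both products in row \<open>i\<close>; the terms with
  \<open>b\<close> cancel because \<open>b\<close> sits in the corner and \<open>A\<close> has unit
  diagonal.\<close>

lemma centralizer_root_elem:
  assumes A: "A \<in> carrier S" and r: "0 < r" "r < n - 1" and ir: "r < i" "i < n"
    and comm: "A * root_elem r a b = root_elem r a b * A"
  shows "a * A $$ (i, r) = (if i = n - 1 then - (a ^ q) * A $$ (n - Suc r, 0) else 0)"
proof -
  let ?X = "root_elem r a b"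
  note Ac = carrierD(1)[OF A]
  have i: "i < n" "0 < n"
    using ir by auto
  have last: "A $$ (i, n - 1) = (if i = n - 1 then 1 else 0)"
    using carrierD(4,5)[OF A] ir by auto
  have "(A * ?X) $$ (i, 0) = (\<Sum>k<n. A $$ (i, k) * ?X $$ (k, 0))"
    using mult_entry[OF Ac root_elem_carrier_mat i] .
  also have "\<dots> = (\<Sum>k<n. (if k = 0 then A $$ (i, k) else 0) + (if k = r then A $$ (i, k) * a else 0)
      + (if k = n - 1 then A $$ (i, k) * b else 0))"
    using r by (intro sum.cong) (auto simp: root_elem_entry)
  also have "\<dots> = A $$ (i, 0) + A $$ (i, r) * a + A $$ (i, n - 1) * b"
    using r ir by (simp add: sum.distrib)
  finally have 1: "(A * ?X) $$ (i, 0) = A $$ (i, 0) + A $$ (i, r) * a + A $$ (i, n - 1) * b" .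
  have "(?X * A) $$ (i, 0) = (\<Sum>k<n. ?X $$ (i, k) * A $$ (k, 0))"
    using mult_entry[OF root_elem_carrier_mat Ac i] .
  also have "\<dots> = (\<Sum>k<n. (if k = i then A $$ (k, 0) else 0)
      + (if k = n - Suc r then if i = n - 1 then - (a ^ q) * A $$ (k, 0) else 0 else 0)
      + (if k = 0 then if i = n - 1 then b * A $$ (k, 0) else 0 else 0))"
    using r ir by (intro sum.cong) (auto simp: root_elem_entry)
  also have "\<dots> = A $$ (i, 0) + (if i = n - 1 then - (a ^ q) * A $$ (n - Suc r, 0) else 0)
      + (if i = n - 1 then b * A $$ (0, 0) else 0)"
    using r ir by (simp add: sum.distrib)
  finally have 2: "(?X * A) $$ (i, 0) = A $$ (i, 0)
      + (if i = n - 1 then - (a ^ q) * A $$ (n - Suc r, 0) else 0)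
      + (if i = n - 1 then b * A $$ (0, 0) else 0)" .
  show ?thesis
    using 1 2 comm last carrierD(4)[OF A i(2)] by (auto simp: mult.commute split: if_splits)
qed

text \<open>For \<open>n - c \<le> r\<close> the off-diagonal entries of a root element lie in the
  columns 0 and \<open>n - Suc r\<close>, both less than \<open>c\<close>. So it belongs to
  \<open>fixer c\<close> and tests column \<open>r\<close> of \<open>A\<close>.\<close>

lemma centralizer_fixer:
  assumes c: "0 < c" "c < n"
  shows "centralizer_set S (fixer c) \<subseteq> fixer (n - c)"
proof
  fix A assume AC: "A \<in> centralizer_set S (fixer c)"
  then have A: "A \<in> carrier S"
    by (simp add: centralizer_set_def)
  have "A $$ (i, r) = 0" if ir: "i < n" "r < i" "n - c \<le> r" for i r
  proof -
    have r: "0 < r" "r < n - 1"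
      using ir c by auto
    have *: "a * A $$ (i, r) = (if i = n - 1 then - (a ^ q) * A $$ (n - Suc r, 0) else 0)" for a
    proof -
      obtain b where b: "root_elem r a b \<in> carrier S"
        using root_elem_exists[OF r] by blast
      have "root_elem r a b \<in> fixer c"
        using b ir c by (auto simp: fixer_def supp_sub_def root_elem_entry split: if_splits)
      then have "A * root_elem r a b = root_elem r a b * A"
        using AC by (simp add: centralizer_set_def)
      then show ?thesis
        using centralizer_root_elem[OF A r] ir by blast
    qed
    \<comment> \<open>In the last row, the instance \<open>a = 1\<close> eliminates
      \<open>A $$ (n - Suc r, 0)\<close>; an \<open>a\<close> moved by the Frobenius then forces
      zero.\<close>
    obtain a :: 'a where a: "a ^ q \<noteq> a"
      using frob_nontrivial by blast
    have "a * A $$ (i, r) = a ^ q * A $$ (i, r)"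
      using *[of 1] *[of a] by (auto split: if_splits)
    then show ?thesis
      using a by simp
  qed
  then show "A \<in> fixer (n - c)"
    using A by (auto simp: fixer_def supp_sub_def) (meson not_le)
qed

end

section \<open>The chain\<close>

locale unitary_unipotent_2m1 = unitary_unipotent_odd +
  fixes m :: nat
  assumes n_eq: "n = 2 * m + 1" and m_pos: "0 < m"
begin

text \<open>The layers of the descending filtration \<open>k = 0, 1, 2, 3\<close> of \<open>fixer (n - c)\<close>, each of which
  \<open>fixer (c + 1)\<close> moves into the next one: the corner entry \<open>(c, 2m - c)\<close> dies first, then the
  rest of row \<open>c\<close> and of column \<open>2m - c\<close>.\<close>
definition layer :: "nat \<Rightarrow> nat \<Rightarrow> nat \<Rightarrow> nat \<Rightarrow> bool" where
  "layer c k i j \<longleftrightarrow> c \<le> i \<and> j + c \<le> 2 * m \<and>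
     k + of_bool (i = c) + of_bool (j + c = 2 * m) \<le> 2"

lemma row_closed_layer: "row_closed (layer c k)"
  by (auto simp: row_closed_def layer_def)

text \<open>By \<open>fixer_eq\<close>, \<open>y\<close> lives in columns at most \<open>c\<close>
  and rows at least \<open>2 * m - c\<close>, so the inner index of a product can only be
  \<open>2 * m - c\<close> or \<open>c\<close>. The product leaves that column or row, and the lost
  indicator pays for \<open>Suc k\<close>.\<close>

lemma gcomm_layer:
  assumes "x \<in> supp_sub (layer c k)" "y \<in> fixer (Suc c)"
  shows "gcomm S x y \<in> supp_sub (layer c (Suc k))"
  using assms(1) assms(2)[unfolded fixer_eq] row_closed_layer
proof (rule gcomm_supp_sub)
  fix i l j assume "j < l" "l < i" "i < n" "layer c k i l" "j < Suc c \<and> n \<le> l + Suc c"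
  then show "layer c (Suc k) i j"
    by (auto simp: layer_def n_eq)
next
  fix i l j assume "j < l" "l < i" "i < n" "l < Suc c \<and> n \<le> i + Suc c" "layer c k l j"
  then show "layer c (Suc k) i j"
    by (auto simp: layer_def n_eq)
qed

lemma supp_sub_layer_trivial: "3 \<le> k \<Longrightarrow> supp_sub (layer c k) = {1\<^sub>m n}"
proof -
  assume "3 \<le> k"
  then have "layer c k = (\<lambda>i j. False)"
    by (auto simp: layer_def fun_eq_iff)
  then show ?thesis
    by (simp add: supp_sub_False)
qed

text \<open>By \<open>fixer_eq\<close> the column bound also yields the row bound
  \<open>c \<le> i\<close>.\<close>

lemma fixer_subset_layer: "c \<le> n \<Longrightarrow> fixer (n - c) \<subseteq> supp_sub (layer c 0)"
  unfolding fixer_eq using n_eq by (intro subsetI, elim supp_sub_mono) (auto simp: layer_def)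

section \<open>Vanishing of the iterated commutators\<close>

lemma comm_iter_fixer_trivial:
  assumes "c \<le> n" "X \<subseteq> fixer (n - c)" "3 \<le> k"
  shows "comm_iter S X (fixer (Suc c)) k = {\<one>}"
proof -
  have "comm_iter S X (fixer (Suc c)) k \<subseteq> supp_sub (layer c k)"
  proof (rule comm_iter_subset)
    show "X \<subseteq> supp_sub (layer c 0)"
      using assms fixer_subset_layer by blast
  qed (auto intro: gcomm_layer subgroup_supp_sub row_closed_layer)
  then show ?thesis
    using one_in_comm_iter[of k X "fixer (Suc c)"] supp_sub_layer_trivial[OF assms(3)] assms(3)
    by auto
qed

lemma comm_iter_carrier_trivial:
  assumes "X \<subseteq> carrier S" "4 \<le> k"
  shows "comm_iter S X (fixer (Suc m)) k = {\<one>}"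
proof -
  \<comment> \<open>The filtration for \<open>c = m\<close>, delayed by one step: as
    \<open>n - m = Suc m\<close>, the first commutators fall into \<open>fixer (n - m)\<close>,
    hence into layer 0.\<close>
  define H where "H l = (case l of 0 \<Rightarrow> carrier S | Suc l \<Rightarrow> supp_sub (layer m l))" for l
  have "comm_iter S X (fixer (Suc m)) k \<subseteq> H k"
  proof (rule comm_iter_subset)
    show "X \<subseteq> H 0"
      using assms by (simp add: H_def)
    show "subgroup (H l) S" for l
      by (cases l) (auto simp: H_def intro: subgroup_self subgroup_supp_sub row_closed_layer)
    fix l x y assume x: "x \<in> H l" and y: "y \<in> fixer (Suc m)"
    show "gcomm S x y \<in> H (Suc l)"
    proof (cases l)
      case 0
      then have "gcomm S x y \<in> fixer (Suc m)"
        using gcomm_fixer' x y by (simp add: H_def)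
      then show ?thesis
        using 0 fixer_subset_layer[of m] by (auto simp: H_def n_eq)
    next
      case (Suc l')
      then show ?thesis
        using gcomm_layer x y by (simp add: H_def)
    qed
  qed
  then show ?thesis
    using one_in_comm_iter[of k X "fixer (Suc m)"] supp_sub_layer_trivial[of "k - 1" m] assms(2)
    by (cases k) (auto simp: H_def)
qed

lemma fixer_last: "fixer (2 * m) = carrier S"
proof -
  have "j < 2 * m" if "j < i" "i < n" for i j
    using that n_eq by simp
  then show ?thesis
    by (auto simp: fixer_def supp_sub_def)
qed

lemma oliver_chain_carrier:
  assumes p: "5 \<le> p"
  shows "oliver_chain S p (carrier S)"
proof -
  \<comment> \<open>Starting at 1 instead of \<open>fixer m\<close>, the first step has all of
    \<open>S\<close> as centralizer and uses four commutators; later steps use three.\<close>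
  define Q where "Q i = (if i = 0 then {\<one>} else fixer (m + i))" for i
  show ?thesis
    unfolding oliver_chain_def
  proof (intro exI[of _ m] exI[of _ Q] conjI allI ballI impI)
    show "Q 0 = {\<one>}"
      by (simp add: Q_def)
    show "Q m = carrier S"
      using m_pos fixer_last by (simp add: Q_def mult_2)
    show "Q i \<lhd> S" for i
      using normal_fixer one_is_normal by (simp add: Q_def)
    show "Q i \<subseteq> Q (Suc i)" for i
    proof (cases "i = 0")
      case True
      then show ?thesis
        using subgroup.one_closed[OF subgroup_fixer] by (simp add: Q_def)
    next
      case False
      then show ?thesis
        by (auto simp: Q_def fixer_def elim: supp_sub_mono)
    qed
    fix i assume i: "i \<in> {1..m}"
    show "comm_iter S (Omega1 S p (centralizer_set S (Q (i - 1)))) (Q i) (p - 1) = {\<one>}"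
    proof (cases "i = 1")
      case True
      have "Omega1 S p (centralizer_set S (Q (i - 1))) \<subseteq> carrier S"
        by (rule Omega1_subset[OF subgroup_self]) (auto simp: centralizer_set_def)
      then show ?thesis
        using comm_iter_carrier_trivial p True by (simp add: Q_def)
    next
      case False
      \<comment> \<open>With this \<open>c\<close> the step goes from
        \<open>Q (i - 1) = fixer c\<close> to \<open>Q i = fixer (Suc c)\<close>; here
        \<open>i > 1\<close>, so \<open>Q (i - 1)\<close> is not the exceptional
        \<open>Q 0\<close>.\<close>
      define c where "c = m + (i - 1)"
      have c: "0 < c" "c < n" "m + i = Suc c"
        using i m_pos n_eq by (auto simp: c_def)
      have "Omega1 S p (centralizer_set S (fixer c)) \<subseteq> fixer (n - c)"
        using c by (intro Omega1_subset subgroup_fixer centralizer_fixer)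
      then show ?thesis
        using comm_iter_fixer_trivial[of c] c p False i by (simp add: Q_def c_def)
    qed
  qed
qed

end

section \<open>Finite fields\<close>

text \<open>Multiplication by a nonzero \<open>x\<close> permutes the nonzero elements; compare
  their products.\<close>

lemma finite_field_power_card:
  fixes x :: "'a :: {field, finite}"
  shows "x ^ card (UNIV :: 'a set) = x"
proof (cases "x = 0")
  case False
  let ?U = "UNIV - {0 :: 'a}"
  have card: "card (UNIV :: 'a set) = Suc (card ?U)"
    by (rule card.remove) auto
  have "bij_betw ((*) x) ?U ?U"
    by (rule bij_betwI[where g = "\<lambda>y. y / x"]) (use False in auto)
  then have "(\<Prod>y\<in>?U. x * y) = \<Prod>?U"
    by (rule prod.reindex_bij_betw)
  then have "x ^ card ?U * \<Prod>?U = \<Prod>?U"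
    by (simp only: prod.distrib prod_constant)
  then have "x ^ card ?U = 1"
    by (simp del: card_Diff_insert)
  then show ?thesis
    unfolding card power_Suc by simp
qed (simp add: power_0_left)

text \<open>Translation by 1 permutes the field; comparing sums shows that its cardinality is zero
  in it.\<close>

lemma finite_field_CHAR:
  assumes "prime p" "card (UNIV :: 'a :: {field, finite} set) = p ^ k"
  shows "CHAR('a) = p"
proof -
  have "bij_betw (\<lambda>x :: 'a. x + 1) UNIV UNIV"
    by (rule bij_betwI[where g = "\<lambda>y. y - 1"]) auto
  then have "(\<Sum>x\<in>UNIV. x + 1 :: 'a) = \<Sum>UNIV"
    by (rule sum.reindex_bij_betw)
  then have "of_nat (card (UNIV :: 'a set)) = (0 :: 'a)"
    by (simp add: sum.distrib)
  then have "of_nat p = (0 :: 'a)"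
    by (simp add: assms)
  then have "CHAR('a) dvd p"
    by (simp add: of_nat_eq_0_iff_char_dvd)
  then show ?thesis
    using assms(1) CHAR_not_1' by (auto simp: prime_nat_iff)
qed

text \<open>\<open>X^q - X\<close> is a nonzero polynomial of degree at most \<open>q\<close>, so it
  cannot vanish on the whole field.\<close>

lemma exists_power_neq_self:
  assumes "1 < q" "q < card (UNIV :: 'a :: {field, finite} set)"
  shows "\<exists>a :: 'a. a ^ q \<noteq> a"
proof (rule ccontr)
  assume "\<not> ?thesis"
  then have all: "a ^ q = a" for a :: 'a
    by blast
  let ?p = "monom 1 q - monom 1 1 :: 'a poly"
  have "coeff ?p q = 1"
    using assms by simp
  then have "?p \<noteq> 0"
    by (metis coeff_0 zero_neq_one)
  then have "card {x. poly ?p x = 0} \<le> degree ?p"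
    by (rule card_poly_roots_bound)
  also have "\<dots> \<le> q"
    using assms by (intro degree_diff_le) (auto intro: order_trans[OF degree_monom_le])
  finally show False
    using assms by (simp add: poly_monom all)
qed

theorem theorem3p9:
  fixes p q e m :: nat
  assumes "prime p" and "p \<ge> 5" and "e \<ge> 1" and "q = p ^ e" and "m \<ge> 1"
    and "card (UNIV :: 'a set) = q ^ 2"
  shows "oliver_subgroup (lower_unitri_unitary q (2 * m + 1) :: ('a :: {field, finite}) mat monoid) p
           = carrier (lower_unitri_unitary q (2 * m + 1) :: 'a mat monoid)"
proof -
  have char: "CHAR('a) = p"
    using assms by (intro finite_field_CHAR[of p "e * 2"]) (auto simp: power_mult)
  have "1 < q"
    using assms one_less_power[of p e] by simp
  \<comment> \<open>The \<open>q\<close>-th power is additive as the characteristic is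
    \<open>p\<close>, an involution as \<open>x ^ (q ^ 2) = x\<close>, and nontrivial as
    \<open>q < q ^ 2\<close>.\<close>
  interpret unitary_unipotent_2m1 q "2 * m + 1" "lower_unitri_unitary q (2 * m + 1) :: 'a mat monoid" m
  proof
    show "0 < q"
      using \<open>1 < q\<close> by simp
    show "(x + y) ^ q = x ^ q + y ^ q" for x y :: 'a
      using assms char by (intro freshmans_dream'[of q e]) auto
    show "(x ^ q) ^ q = x" for x :: 'a
      using finite_field_power_card[of x] assms(6) by (simp add: power2_eq_square power_mult)
    show "\<exists>a :: 'a. a ^ q \<noteq> a"
      using \<open>1 < q\<close> assms(6) by (intro exists_power_neq_self) (auto simp: power2_eq_square)
    have "\<not> p dvd 2"
      using assms(2) by (auto dest: dvd_imp_le)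
    then show "(2 :: 'a) \<noteq> 0"
      using of_nat_eq_0_iff_char_dvd[of 2, where ?'a = 'a] char by simp
  qed (use assms in auto)
  show ?thesis
    by (rule oliver_subgroup_eq_carrierI[OF oliver_chain_carrier[OF assms(2)]])
qed

end
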